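(* Fix $s \in (0,1)$, and suppose that $E \subseteq \mathbb{R}^2$ is measurable and that $A \subseteq S^1$ is measurable with positive arc-length measure. Suppose there exist a sequence of scales $r_n > 0$ with $r_n \to 0$ and a constant $C < \infty$ (independent of $n$) such that $$\int_A \left|\pi_{\theta}\left(E(r_n)\right)\right| \, d\theta \le C r_n^{s} \quad \text{for all } n.$$ Then $\dim_{\mathcal{H}} E \le 1 - s$.
   Context: For an angle $\theta$ (points of the circle $S^1$ are identified with angles $\theta \in [0,2\pi)$, and $d\theta$ is arc-length measure), $\pi_\theta$ denotes orthogonal projection of $\mathbb{R}^2$ onto the line $L_\theta$ through the origin making angle $\theta$ with the positive $x$-axis. For a subset $X$ of $L_\theta$, $|X|$ denotes its one-dimensional Lebesgue measure (length) within $L_\theta$. For $r > 0$, $E(r) = \{x \in \mathbb{R}^2 : \operatorname{dist}(x,E) < r\}$ is the $r$-neighborhood of $E$. $\dim_{\mathcal{H}}$ denotes Hausdorff dimension. *)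

theory Defs
  imports "HOL-Analysis.Analysis"
begin

subsection \<open>Hausdorff dimension\<close>

text \<open>
  The weight \<open>(diam U)\<^sup>s\<close> of a covering set, with the usual conventions for \<open>s = 0\<close>: nonempty sets
  have weight 1 and the empty set has weight 0. The case distinction is needed because
  \<open>0 powr 0 = 0\<close> in the library.
\<close>
definition diam_powr :: "real \<Rightarrow> 'a::metric_space set \<Rightarrow> real" where
  "diam_powr s U = (if U = {} then 0 else if s = 0 then 1 else diameter U powr s)"

text \<open>
  Boundedness of the covering sets is required explicitly, since \<^const>\<open>diameter\<close> is real-valued
  and not meaningful on unbounded sets. Finite covers are included by padding with empty sets.
\<close>
definition hausdorff_premeasure :: "real \<Rightarrow> real \<Rightarrow> 'a::metric_space set \<Rightarrow> ennreal" where
  "hausdorff_premeasure s \<delta> E =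
     (INF U \<in> {U :: nat \<Rightarrow> 'a set. E \<subseteq> (\<Union>i. U i) \<and> (\<forall>i. bounded (U i) \<and> diameter (U i) \<le> \<delta>)}.
        \<Sum>i. ennreal (diam_powr s (U i)))"

definition hausdorff_measure :: "real \<Rightarrow> 'a::metric_space set \<Rightarrow> ennreal" where
  "hausdorff_measure s E = (SUP \<delta> \<in> {0<..}. hausdorff_premeasure s \<delta> E)"

definition hausdorff_dim :: "'a::metric_space set \<Rightarrow> ennreal" where
  "hausdorff_dim E = Inf {ennreal s | s. 0 \<le> s \<and> hausdorff_measure s E = 0}"


subsection \<open>Neighborhoods and projections\<close>

text \<open>
  \<open>E \<noteq> {}\<close> enforces \<open>dist(x, {}) = \<infinity>\<close>; the library has \<open>infdist x {} = 0\<close>.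
\<close>
definition nbhd :: "real \<Rightarrow> 'a::metric_space set \<Rightarrow> 'a set" where
  "nbhd r E = {x. E \<noteq> {} \<and> infdist x E < r}"

definition dir :: "real \<Rightarrow> real ^ 2" where
  "dir \<theta> = vector [cos \<theta>, sin \<theta>]"

definition line :: "real \<Rightarrow> (real ^ 2) set" where
  "line \<theta> = span {dir \<theta>}"

definition proj :: "real \<Rightarrow> real ^ 2 \<Rightarrow> real ^ 2" where
  "proj \<theta> x = (x \<bullet> dir \<theta>) *\<^sub>R dir \<theta>"

text \<open>
  Length within \<^term>\<open>line \<theta>\<close>, transported from the real line by the isometric
  parametrization \<open>t \<mapsto> t *\<^sub>R dir \<theta>\<close>; meant for \<open>X \<subseteq> line \<theta>\<close>.
\<close>
definition line_length :: "real \<Rightarrow> (real ^ 2) set \<Rightarrow> ennreal" where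
  "line_length \<theta> X = emeasure lebesgue {t :: real. t *\<^sub>R dir \<theta> \<in> X}"

lemma norm_dir [simp]: "norm (dir \<theta>) = 1"
  by (simp add: dir_def norm_eq_1 inner_vec_def sum_2 flip: power2_eq_square)

text \<open>\<^const>\<open>proj\<close> is the orthogonal projection onto \<^const>\<open>line\<close>.\<close>

lemma proj_in_line: "proj \<theta> x \<in> line \<theta>"
  by (simp add: proj_def line_def span_base span_scale)

lemma proj_orthogonal:
  assumes "y \<in> line \<theta>"
  shows "(x - proj \<theta> x) \<bullet> y = 0"
proof -
  obtain k where "y = k *\<^sub>R dir \<theta>"
    using assms by (auto simp: line_def span_singleton)
  moreover have "dir \<theta> \<bullet> dir \<theta> = 1"
    by (metis norm_dir norm_eq_1)
  ultimately show ?thesis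
    by (simp add: proj_def inner_diff_left)
qed

end

theory Submission
  imports Defs
begin

text \<open>
  The measure in Kaufman's proof of Marstrand's projection theorem is replaced here by weights on
  finitely many points, at the single scale \<open>r = r\<^sub>n\<close>. Let \<open>1 - s < t < 1\<close> and
  let \<open>X\<close> be a finite \<open>r\<close>-net of a bounded piece of \<open>E\<close>.

  A finite form of Frostman's lemma (\<open>discrete_frostman\<close>) puts weights on \<open>X\<close>
  such that every ball of radius \<open>\<rho> = 2\<^sup>k r\<close> centred in \<open>X\<close> has weight at most
  \<open>\<rho>\<^sup>t\<close>, while \<open>X\<close> is covered by enlargements of such balls with the sum of
  all \<open>\<rho>\<^sup>t\<close> at most the total weight \<open>W\<close>. So it suffices to show that
  \<open>W\<close> tends to 0 along the given scales: then the piece has covers with arbitrarily small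
  sums, its \<open>t\<close>-dimensional Hausdorff measure vanishes, and the same follows for
  \<open>E\<close> by countable subadditivity (\<open>hausdorff_measure_Union_eq_0\<close>).

  To bound \<open>W\<close>, smear each weight over an interval of radius \<open>r\<close> after projecting to
  the line in direction \<open>\<theta>\<close>. The resulting function has integral \<open>2rW\<close> and lives on
  the projection of the \<open>r\<close>-neighborhood of \<open>E\<close>, so by Cauchy-Schwarz that
  projection is long unless the \<open>L\<^sup>2\<close> norm is large. The square of the latter counts pairs
  of points whose projections are closer than \<open>2r\<close>. Two points at distance \<open>d\<close> are in
  this position only for a set of directions of measure \<open>O(min 1 (r/d))\<close>
  (\<open>measure_thin_angles_le_dyadic_kernel\<close>), and the ball condition sums these measures to
  \<open>O(r\<^sup>t W)\<close> (\<open>dyadic_kernel_sum_le\<close>). Averaging over \<open>A\<close>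
  gives \<open>W = O(r\<^sup>t\<^sup>-\<^sup>1)\<close> times the average length of the projections
  (\<open>mass_le_projection_average\<close>), hence \<open>W = O(r\<^sup>s\<^sup>+\<^sup>t\<^sup>-\<^sup>1)\<close>
  by hypothesis, and the exponent is positive.
\<close>

section \<open>A finite Frostman lemma\<close>

text \<open>
  Points are weighted one after another, each receiving the largest weight that the bounds still
  allow. At that moment one of the sets containing the point becomes saturated; since no set may
  exceed its bound and weights are nonnegative, later points cannot spoil saturation.
\<close>

lemma exists_saturated_weights:
  fixes B :: "'i \<Rightarrow> 'a set" and b :: "'i \<Rightarrow> real"
  assumes "finite X" "finite I" "\<And>i. i \<in> I \<Longrightarrow> 0 \<le> b i"
    and cover: "X \<subseteq> (\<Union>i\<in>I. B i)"
  shows "\<exists>w. (\<forall>x. 0 \<le> w x) \<and> (\<forall>i\<in>I. sum w (X \<inter> B i) \<le> b i) \<and>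
             (\<forall>x\<in>X. \<exists>i\<in>I. x \<in> B i \<and> sum w (X \<inter> B i) = b i)"
  using \<open>finite X\<close> cover
proof (induction X rule: finite_induct)
  case empty
  show ?case using assms(3) by (intro exI[of _ "\<lambda>_. 0"]) auto
next
  case (insert x X)
  then obtain w where w0: "\<And>y. 0 \<le> w y"
    and wb: "\<And>i. i \<in> I \<Longrightarrow> sum w (X \<inter> B i) \<le> b i"
    and wt: "\<And>y. y \<in> X \<Longrightarrow> \<exists>i\<in>I. y \<in> B i \<and> sum w (X \<inter> B i) = b i"
    by blast
  define slack where "slack i = b i - sum w (X \<inter> B i)" for i
  define J where "J = {i \<in> I. x \<in> B i}"
  have J: "finite J" "J \<noteq> {}" using insert.prems \<open>finite I\<close> by (auto simp: J_def)
  define m where "m = Min (slack ` J)"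
  have m_le: "m \<le> slack i" if "i \<in> J" for i using J that by (auto simp: m_def)
  obtain j where j: "j \<in> J" "slack j = m"
    proof -
    have "m \<in> slack ` J" unfolding m_def using J by (intro Min_in) auto
    then show ?thesis using that by blast
  qed
  have m0: "0 \<le> m" using j wb by (auto simp: slack_def J_def simp flip: j(2))
  define w' where "w' = w(x := m)"
  have old: "sum w' (X \<inter> B i) = sum w (X \<inter> B i)" for i
    using insert.hyps by (intro sum.cong) (auto simp: w'_def)
  have new: "sum w' (insert x X \<inter> B i) = (if x \<in> B i then m else 0) + sum w (X \<inter> B i)" for i
    using insert.hyps old[of i] by (auto simp: w'_def)
  have bound: "sum w' (insert x X \<inter> B i) \<le> b i" if "i \<in> I" for i
    using m_le[of i] wb[OF that] that unfolding new by (auto simp: J_def slack_def)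
  show ?case
  proof (intro exI[of _ w'] conjI allI ballI)
    show "0 \<le> w' y" for y using w0 m0 by (simp add: w'_def)
    show "sum w' (insert x X \<inter> B i) \<le> b i" if "i \<in> I" for i by (rule bound[OF that])
    fix y assume "y \<in> insert x X"
    then consider "y = x" | "y \<in> X" by blast
    then show "\<exists>i\<in>I. y \<in> B i \<and> sum w' (insert x X \<inter> B i) = b i"
    proof cases
      case 1
      then show ?thesis using j unfolding new by (auto simp: J_def slack_def intro!: bexI[of _ j])
    next
      case 2
      then obtain i where i: "i \<in> I" "y \<in> B i" "sum w (X \<inter> B i) = b i" using wt by blast
      then have "sum w' (insert x X \<inter> B i) = b i"
        using bound[OF i(1)] m0 unfolding new by (auto split: if_splits)
      then show ?thesis using i by blast
    qed
  qed
qed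

text \<open>
  The finite stand-in for Frostman's lemma, with weights and cover dual to each other. In saturated
  weights for the balls of radius \<open>2\<^sup>k r\<close>, every point lies in a ball whose weight
  equals its radius to the power \<open>t\<close>. Among the saturated balls, Vitali's lemma selects
  disjoint ones whose fivefold enlargements still cover, and disjointness bounds the sum of the
  radii to the power \<open>t\<close> by the total weight.
\<close>

lemma discrete_frostman:
  fixes X :: "'a::euclidean_space set"
  assumes X: "finite X" and r: "0 < r"
  obtains w D where "\<And>x. 0 \<le> w x"
    and "\<And>x k. x \<in> X \<Longrightarrow> k \<le> N \<Longrightarrow> sum w (X \<inter> cball x (2^k * r)) \<le> (2^k * r) powr t"
    and "finite D" and "X \<subseteq> (\<Union>(x,k)\<in>D. cball x (5 * (2^k * r)))"
    and "(\<Sum>(x,k)\<in>D. (2^k * r) powr t) \<le> sum w X"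
proof -
  define I where "I = X \<times> {..N::nat}"
  define \<rho> where "\<rho> = (\<lambda>(x::'a, k::nat). 2^k * r)"
  define B where "B i = cball (fst i) (\<rho> i)" for i
  have I: "finite I" using X by (simp add: I_def)
  have \<rho>: "0 < \<rho> i" for i using r by (auto simp: \<rho>_def split: prod.split)
  have cover: "X \<subseteq> (\<Union>i\<in>I. B i)"
  proof
    fix x assume "x \<in> X"
    then have "(x, 0) \<in> I" "x \<in> B (x, 0)" using r by (auto simp: I_def B_def \<rho>_def)
    then show "x \<in> (\<Union>i\<in>I. B i)" by blast
  qed
  have "\<exists>w. (\<forall>x. 0 \<le> w x) \<and> (\<forall>i\<in>I. sum w (X \<inter> B i) \<le> \<rho> i powr t) \<and>
             (\<forall>x\<in>X. \<exists>i\<in>I. x \<in> B i \<and> sum w (X \<inter> B i) = \<rho> i powr t)"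
    by (rule exists_saturated_weights[OF X I _ cover]) simp
  then obtain w where w: "\<forall>x. 0 \<le> w x" "\<forall>i\<in>I. sum w (X \<inter> B i) \<le> \<rho> i powr t"
    "\<forall>x\<in>X. \<exists>i\<in>I. x \<in> B i \<and> sum w (X \<inter> B i) = \<rho> i powr t"
    by (elim exE conjE)
  note w0 = w(1)[rule_format] and wb = w(2)[rule_format] and wt = w(3)[rule_format]
  define T where "T = {i \<in> I. sum w (X \<inter> B i) = \<rho> i powr t}"
  have T: "finite T" using I by (simp add: T_def)
  have XT: "X \<subseteq> (\<Union>i\<in>T. cball (fst i) (\<rho> i))" 
  proof
    fix x assume "x \<in> X"
    then obtain i where "i \<in> I" "x \<in> B i" "sum w (X \<inter> B i) = \<rho> i powr t"
      using wt by blast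
    then have "i \<in> T" "x \<in> cball (fst i) (\<rho> i)" by (auto simp only: T_def B_def mem_Collect_eq)
    then show "x \<in> (\<Union>i\<in>T. cball (fst i) (\<rho> i))" by blast
  qed
  have rT: "0 < \<rho> i \<and> \<rho> i \<le> Max (\<rho> ` T)" if "i \<in> T" for i using that T \<rho> by simp
  obtain D where D: "D \<subseteq> T"
    "pairwise (\<lambda>i j. disjnt (cball (fst i) (\<rho> i)) (cball (fst j) (\<rho> j))) D"
    "X \<subseteq> (\<Union>i\<in>D. cball (fst i) (5 * \<rho> i))"
    by (rule Vitali_covering_lemma_cballs[OF XT rT])
  have fD: "finite D" using D T finite_subset by blast
  have "(\<Sum>i\<in>D. \<rho> i powr t) = (\<Sum>i\<in>D. sum w (X \<inter> B i))"
    using D(1) by (intro sum.cong) (auto simp: T_def)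
  also have "\<dots> = sum w (\<Union>i\<in>D. X \<inter> B i)"
  proof (rule sum.UNION_disjoint[symmetric])
    show "\<forall>i\<in>D. \<forall>j\<in>D. i \<noteq> j \<longrightarrow> (X \<inter> B i) \<inter> (X \<inter> B j) = {}"
      using D(2) unfolding pairwise_def disjnt_def B_def by blast
  qed (use X fD in auto)
  also have "\<dots> \<le> sum w X" using X w0 by (intro sum_mono2) auto
  finally have S: "(\<Sum>i\<in>D. \<rho> i powr t) \<le> sum w X" .
  show ?thesis
  proof (rule that[of w D])
    show "sum w (X \<inter> cball x (2^k * r)) \<le> (2^k * r) powr t" if "x \<in> X" "k \<le> N" for x k
      using wb[of "(x,k)"] that by (simp add: I_def B_def \<rho>_def)
    show "X \<subseteq> (\<Union>(x,k)\<in>D. cball x (5 * (2^k * r)))"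
      using D(3) by (auto simp: \<rho>_def case_prod_unfold)
    show "(\<Sum>(x,k)\<in>D. (2^k * r) powr t) \<le> sum w X"
      using S by (simp add: \<rho>_def case_prod_unfold)
  qed (use w0 fD in auto)
qed

section \<open>Energy at scale r\<close>

text \<open>
  A dyadic step-function version of \<open>min 1 (r / d)\<close>, to which it is comparable for
  \<open>0 < d \<le> 2\<^sup>N r\<close>. Its form makes a sum over points immediately a sum of weights of
  balls.
\<close>

definition dyadic_kernel :: "real \<Rightarrow> nat \<Rightarrow> real \<Rightarrow> real" where
  "dyadic_kernel r N d = (\<Sum>k\<le>N. if d \<le> 2^k * r then (1/2)^k else 0)"

text \<open>
  The ball of radius \<open>2\<^sup>k r\<close> contributes at most
  \<open>2\<^sup>-\<^sup>k (2\<^sup>k r)\<^sup>t = r\<^sup>t (2\<^sup>t\<^sup>-\<^sup>1)\<^sup>k\<close>. This is a convergent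
  geometric series because \<open>t < 1\<close>, so the bound depends neither on the number of scales
  nor on the number of points.
\<close>

lemma dyadic_kernel_sum_le:
  fixes w :: "'a::metric_space \<Rightarrow> real"
  assumes "finite X" "0 < r" "t < 1"
    and w: "\<And>k. k \<le> N \<Longrightarrow> sum w (X \<inter> cball x (2^k * r)) \<le> (2^k * r) powr t"
  shows "(\<Sum>y\<in>X. w y * dyadic_kernel r N (dist x y)) \<le> r powr t / (1 - 2 powr (t - 1))"
proof -
  define q :: real where "q = 2 powr (t - 1)"
  have q: "0 < q" "q < 1" using \<open>t < 1\<close> by (auto simp: q_def powr_less_one)
  have "(\<Sum>y\<in>X. w y * dyadic_kernel r N (dist x y))
      = (\<Sum>k\<le>N. \<Sum>y\<in>X. w y * (if dist x y \<le> 2^k * r then (1/2)^k else 0))"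
    unfolding dyadic_kernel_def sum_distrib_left by (rule sum.swap)
  also have "\<dots> = (\<Sum>k\<le>N. (1/2)^k * sum w (X \<inter> cball x (2^k * r)))"
  proof (rule sum.cong[OF refl])
    fix k
    have "(\<Sum>y\<in>X. w y * (if dist x y \<le> 2^k * r then (1/2)^k else 0))
        = (\<Sum>y\<in>X. if y \<in> cball x (2^k * r) then (1/2)^k * w y else 0)"
      by (intro sum.cong) auto
    also have "\<dots> = (\<Sum>y\<in>X \<inter> cball x (2^k * r). (1/2)^k * w y)"
      using \<open>finite X\<close> by (simp add: sum.inter_restrict)
    finally show "(\<Sum>y\<in>X. w y * (if dist x y \<le> 2^k * r then (1/2)^k else 0))
        = (1/2)^k * sum w (X \<inter> cball x (2^k * r))"
      by (simp add: sum_distrib_left)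
  qed
  also have "\<dots> \<le> (\<Sum>k\<le>N. (1/2)^k * (2^k * r) powr t)"
    using w by (intro sum_mono mult_left_mono) auto
  also have "\<dots> = (\<Sum>k\<le>N. r powr t * q ^ k)"
  proof (rule sum.cong[OF refl])
    fix k
    have "q ^ k = (2^k) powr t * (1/2)^k"
    proof -
      have "q ^ k = 2 powr (real k * t - real k)"
        by (simp add: q_def powr_powr[symmetric] powr_realpow[symmetric] powr_powr algebra_simps)
      also have "\<dots> = 2 powr (real k * t) / 2 ^ k"
        by (simp add: powr_diff powr_realpow)
      also have "2 powr (real k * t) = (2^k) powr t"
        by (simp add: powr_powr powr_realpow[symmetric])
      finally show ?thesis by (simp add: power_one_over)
    qed
    then show "(1/2)^k * (2^k * r) powr t = r powr t * q ^ k"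
      using \<open>0 < r\<close> by (simp add: powr_mult)
  qed
  also have "\<dots> = r powr t * (\<Sum>k\<le>N. q ^ k)" by (simp add: sum_distrib_left)
  also have "\<dots> \<le> r powr t * (1 / (1 - q))"
  proof (rule mult_left_mono)
    have "(\<Sum>k\<le>N. q ^ k) \<le> (\<Sum>k. q ^ k)"
      using q by (intro sum_le_suminf summable_geometric) auto
    then show "(\<Sum>k\<le>N. q ^ k) \<le> 1 / (1 - q)" using q suminf_geometric[of q] by simp
  qed simp
  finally show ?thesis by (simp add: q_def)
qed

section \<open>Directions in which two points project close together\<close>

text \<open>
  Jordan's inequality: by concavity, the graph of \<open>sin\<close> on \<open>[0, \<pi>/2]\<close> lies above
  its chord.
\<close>

lemma sin_ge_linear:
  assumes "0 \<le> x" "x \<le> pi / 2"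
  shows "2 / pi * x \<le> sin x"
proof -
  have cvx: "convex_on {0..pi} (\<lambda>x. - sin x)"
    by (rule f''_ge0_imp_convex[where f' = "\<lambda>x. - cos x" and f'' = "\<lambda>x. sin x"])
       (auto intro!: derivative_eq_intros sin_ge_zero)
  define c where "c = 2 / pi * x"
  have c: "0 \<le> c" "c \<le> 1" "x = c * (pi / 2)" using assms by (auto simp: c_def field_simps)
  have "- sin ((1 - c) *\<^sub>R 0 + c *\<^sub>R (pi / 2)) \<le> (1 - c) * (- sin 0) + c * (- sin (pi / 2))"
    using convex_onD[OF cvx, of c 0 "pi/2"] c by simp
  then have "- sin (c * (pi / 2)) \<le> - c" by simp
  then have "- sin x \<le> - c" by (simp only: c(3)[symmetric])
  then show ?thesis by (simp add: c_def)
qed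

lemma abs_sin_ge_linear:
  assumes "\<bar>x\<bar> \<le> pi / 2"
  shows "2 / pi * \<bar>x\<bar> \<le> \<bar>sin x\<bar>"
proof (cases "0 \<le> x")
  case True
  then show ?thesis using sin_ge_linear[of x] assms by simp
next
  case False
  then show ?thesis using sin_ge_linear[of "-x"] assms by simp
qed

lemma inner_dir_polar:
  fixes v :: "real ^ 2"
  obtains \<phi> where "0 \<le> \<phi>" "\<phi> < 2 * pi" "\<And>\<theta>. v \<bullet> dir \<theta> = norm v * cos (\<theta> - \<phi>)"
proof (cases "v = 0")
  case True
  then show ?thesis using that[of 0] by simp
next
  case False
  have "(norm v)\<^sup>2 = (v $ 1)\<^sup>2 + (v $ 2)\<^sup>2"
    unfolding power2_norm_eq_inner by (simp add: inner_vec_def sum_2 power2_eq_square)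
  then have "(v $ 1 / norm v)\<^sup>2 + (v $ 2 / norm v)\<^sup>2 = (norm v)\<^sup>2 / (norm v)\<^sup>2"
    by (simp only: power_divide flip: add_divide_distrib)
  then have "(v $ 1 / norm v)\<^sup>2 + (v $ 2 / norm v)\<^sup>2 = 1"
    using False by simp
  then obtain \<phi> where \<phi>: "0 \<le> \<phi>" "\<phi> < 2 * pi" "v $ 1 / norm v = cos \<phi>" "v $ 2 / norm v = sin \<phi>"
    using sincos_total_2pi by metis
  then have v: "v $ 1 = norm v * cos \<phi>" "v $ 2 = norm v * sin \<phi>"
    using False by (auto simp: field_simps)
  have "v \<bullet> dir \<theta> = norm v * cos (\<theta> - \<phi>)" for \<theta>
  proof -
    have "v \<bullet> dir \<theta> = v $ 1 * cos \<theta> + v $ 2 * sin \<theta>"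
      by (simp add: inner_vec_def sum_2 dir_def)
    also have "\<dots> = norm v * cos (\<theta> - \<phi>)"
      unfolding v cos_diff by (simp add: algebra_simps)
    finally show ?thesis .
  qed
  then show ?thesis using that \<phi> by blast
qed

text \<open>
  The index \<open>m\<close> is that of the interval \<open>[m\<pi>, (m+1)\<pi>)\<close> containing
  \<open>\<tau>\<close>, on which \<open>\<bar>cos\<bar>\<close> vanishes at the midpoint only and Jordan's inequality
  applies. Four intervals are enough because \<open>\<tau>\<close> will be a difference of two angles in
  \<open>[0, 2\<pi>)\<close>.
\<close>

lemma near_zero_of_cos:
  assumes "- (2 * pi) \<le> \<tau>" "\<tau> < 2 * pi"
  shows "\<exists>m\<in>{-2..1::int}. \<bar>\<tau> - (of_int m * pi + pi / 2)\<bar> \<le> pi / 2 * \<bar>cos \<tau>\<bar>"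
proof -
  define m where "m = \<lfloor>\<tau> / pi\<rfloor>"
  define y where "y = \<tau> - (of_int m * pi + pi / 2)"
  have "of_int m \<le> \<tau> / pi" "\<tau> / pi < of_int m + 1"
    unfolding m_def by linarith+
  then have m: "of_int m * pi \<le> \<tau>" "\<tau> < (of_int m + 1) * pi"
    by (auto simp: field_simps)
  then have y: "\<bar>y\<bar> \<le> pi / 2" by (auto simp: y_def abs_if algebra_simps)
  have "-2 \<le> \<tau> / pi" "\<tau> / pi < 2" using assms by (auto simp: field_simps)
  then have mr: "m \<in> {-2..1}" unfolding m_def by (auto simp: le_floor_iff)
  have "\<tau> = y + pi / 2 + of_int m * pi" by (simp add: y_def)
  also have "cos \<dots> = cos (y + pi / 2) * cos (of_int m * pi)"
    by (subst cos_add) (simp add: sin_times_pi_eq_0)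
  finally have "\<bar>cos \<tau>\<bar> = \<bar>sin y\<bar> * \<bar>cos (of_int m * pi)\<bar>"
    by (simp add: abs_mult cos_add)
  also have "\<bar>cos (of_int m * pi)\<bar> = 1"
    by (rule sin_zero_abs_cos_one) (simp add: sin_times_pi_eq_0)
  finally have "2 / pi * \<bar>y\<bar> \<le> \<bar>cos \<tau>\<bar>" using abs_sin_ge_linear[OF y] by simp
  then have "\<bar>y\<bar> \<le> pi / 2 * \<bar>cos \<tau>\<bar>" by (simp add: field_simps)
  then show ?thesis using mr unfolding y_def by blast
qed

lemma sets_thin_angles:
  assumes "A \<in> sets lebesgue"
  shows "A \<inter> {\<theta>. \<bar>v \<bullet> dir \<theta>\<bar> < c} \<in> sets lebesgue"
proof -
  have "{\<theta>. \<bar>v \<bullet> dir \<theta>\<bar> < c} \<in> sets borel"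
    unfolding dir_def inner_vec_def sum_2 vector_2 by measurable
  then show ?thesis using assms by (auto intro: sets_completionI_sets)
qed

text \<open>
  In polar coordinates the condition says that \<open>\<bar>cos (\<theta> - \<phi>)\<bar> < 2r / norm v\<close>, where
  \<open>\<phi>\<close> is the direction of \<open>v\<close>. So \<open>\<theta>\<close> lies in one of four intervals of
  length \<open>2\<pi>r / norm v\<close> around the angles orthogonal to \<open>v\<close>.
\<close>

lemma measure_thin_angles_le:
  fixes v :: "real ^ 2"
  assumes "v \<noteq> 0" "0 < r" "A \<subseteq> {0..<2 * pi}" "A \<in> sets lebesgue"
  shows "measure lebesgue (A \<inter> {\<theta>. \<bar>v \<bullet> dir \<theta>\<bar> < 2 * r}) \<le> 8 * pi * r / norm v"
proof -
  obtain \<phi> where \<phi>: "0 \<le> \<phi>" "\<phi> < 2 * pi" "\<And>\<theta>. v \<bullet> dir \<theta> = norm v * cos (\<theta> - \<phi>)"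
    using inner_dir_polar by metis
  define \<delta> where "\<delta> = pi * r / norm v"
  have \<delta>: "0 \<le> \<delta>" using assms by (simp add: \<delta>_def)
  define c where "c m = \<phi> + (of_int m * pi + pi / 2)" for m :: int
  have sub: "A \<inter> {\<theta>. \<bar>v \<bullet> dir \<theta>\<bar> < 2 * r} \<subseteq> (\<Union>m\<in>{-2..1}. cball (c m) \<delta>)"
  proof
    fix \<theta> assume \<theta>: "\<theta> \<in> A \<inter> {\<theta>. \<bar>v \<bullet> dir \<theta>\<bar> < 2 * r}"
    then have "0 \<le> \<theta>" "\<theta> < 2 * pi" using assms by auto
    then obtain m where m: "m \<in> {-2..1}"
      "\<bar>\<theta> - \<phi> - (of_int m * pi + pi / 2)\<bar> \<le> pi / 2 * \<bar>cos (\<theta> - \<phi>)\<bar>"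
      using near_zero_of_cos[of "\<theta> - \<phi>"] \<phi> by auto
    have "norm v * \<bar>cos (\<theta> - \<phi>)\<bar> < 2 * r" using \<theta> \<phi>(3) by (simp add: abs_mult)
    then have "\<bar>cos (\<theta> - \<phi>)\<bar> \<le> 2 * r / norm v" using assms by (simp add: field_simps)
    then have "pi / 2 * \<bar>cos (\<theta> - \<phi>)\<bar> \<le> pi / 2 * (2 * r / norm v)"
      by (intro mult_left_mono) auto
    also have "\<dots> = \<delta>" by (simp add: \<delta>_def)
    finally have "\<theta> \<in> cball (c m) \<delta>" using m(2) by (simp add: c_def dist_real_def abs_minus_commute algebra_simps)
    then show "\<theta> \<in> (\<Union>m\<in>{-2..1}. cball (c m) \<delta>)" using m(1) by blast
  qed
  have "measure lebesgue (A \<inter> {\<theta>. \<bar>v \<bullet> dir \<theta>\<bar> < 2 * r}) \<le> measure lebesgue (\<Union>m\<in>{-2..1}. cball (c m) \<delta>)"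
  proof (rule measure_mono_fmeasurable[OF sub])
    show "A \<inter> {\<theta>. \<bar>v \<bullet> dir \<theta>\<bar> < 2 * r} \<in> sets lebesgue"
      using assms by (intro sets_thin_angles)
    show "(\<Union>m\<in>{-2..1}. cball (c m) \<delta>) \<in> fmeasurable lebesgue"
      by (intro fmeasurable.finite_UN) auto
  qed
  also have "\<dots> \<le> (\<Sum>m\<in>{-2..1}. measure lebesgue (cball (c m) \<delta>))"
    by (intro measure_UNION_le) auto
  also have "\<dots> = (\<Sum>m\<in>{-2..1::int}. 2 * \<delta>)"
    using \<delta> by (intro sum.cong) (auto simp: cball_eq_atLeastAtMost)
  also have "\<dots> = 8 * pi * r / norm v" by (simp add: \<delta>_def)
  finally show ?thesis .
qed

text \<open>
  Transversality of projections in the form used for the energy: only the smallest ball of radius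
  \<open>2\<^sup>k r\<close> containing \<open>v\<close> matters, and there \<open>r / norm v\<close> is less than
  \<open>2 \<cdot> 2\<^sup>-\<^sup>k\<close>, unless \<open>k = 0\<close>, when the trivial bound by the length of
  the full circle is good enough.
\<close>

lemma measure_thin_angles_le_dyadic_kernel:
  fixes v :: "real ^ 2"
  assumes "0 < r" "norm v \<le> 2 ^ N * r" "A \<subseteq> {0..<2 * pi}" "A \<in> sets lebesgue"
  shows "measure lebesgue (A \<inter> {\<theta>. \<bar>v \<bullet> dir \<theta>\<bar> < 2 * r}) \<le> 16 * pi * dyadic_kernel r N (norm v)"
proof -
  define k where "k = (LEAST k. norm v \<le> 2 ^ k * r)"
  have k: "norm v \<le> 2 ^ k * r" unfolding k_def by (rule LeastI) (rule assms(2))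
  have kN: "k \<le> N" unfolding k_def by (rule Least_le) (rule assms(2))
  have "(1/2)^k \<le> dyadic_kernel r N (norm v)"
    unfolding dyadic_kernel_def using k kN
    by (intro order.trans[OF _ member_le_sum[of k]]) auto
  moreover have "measure lebesgue (A \<inter> {\<theta>. \<bar>v \<bullet> dir \<theta>\<bar> < 2 * r}) \<le> 16 * pi * (1/2)^k"
  proof (cases k)
    case 0
    have "measure lebesgue (A \<inter> {\<theta>. \<bar>v \<bullet> dir \<theta>\<bar> < 2 * r}) \<le> measure lebesgue {0..2*pi}"
      using assms(3,4) by (intro measure_mono_fmeasurable sets_thin_angles) auto
    then have "measure lebesgue (A \<inter> {\<theta>. \<bar>v \<bullet> dir \<theta>\<bar> < 2 * r}) \<le> 2 * pi" by simp
    also have "2 * pi \<le> 16 * pi * (1/2)^k" using 0 by simp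
    finally show ?thesis .
  next
    case (Suc j)
    then have "\<not> norm v \<le> 2 ^ j * r"
      using not_less_Least[of j "\<lambda>k. norm v \<le> 2 ^ k * r"] unfolding k_def by simp
    then have v: "2 ^ j * r < norm v" by simp
    then have v0: "v \<noteq> 0" using \<open>0 < r\<close> by (auto simp: mult_less_0_iff not_less less_imp_le)
    have "measure lebesgue (A \<inter> {\<theta>. \<bar>v \<bullet> dir \<theta>\<bar> < 2 * r}) \<le> 8 * pi * r / norm v"
      by (rule measure_thin_angles_le[OF v0 assms(1,3,4)])
    also have "\<dots> \<le> 8 * pi * r / (2 ^ j * r)"
      using v v0 \<open>0 < r\<close> by (intro divide_left_mono) auto
    also have "\<dots> = 16 * pi * (1/2)^k" using \<open>0 < r\<close> by (simp add: Suc power_one_over)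
    finally show ?thesis .
  qed
  ultimately show ?thesis by (meson mult_left_mono order.trans pi_ge_zero mult_nonneg_nonneg zero_le_numeral)
qed

section \<open>Length of projections against energy\<close>

text \<open>
  The projection of a ball is an interval of the same radius. In particular, projected neighborhoods
  are open, so their length is not lost to non-measurability.
\<close>

lemma proj_nbhd_preimage:
  "{u. u *\<^sub>R dir \<theta> \<in> proj \<theta> ` nbhd r E} = (\<Union>e\<in>E. {e \<bullet> dir \<theta> - r <..< e \<bullet> dir \<theta> + r})"
  (is "?L = ?R")
proof (intro set_eqI iffI)
  fix u assume "u \<in> ?L"
  then obtain x where x: "x \<in> nbhd r E" "u *\<^sub>R dir \<theta> = (x \<bullet> dir \<theta>) *\<^sub>R dir \<theta>"
    by (auto simp: proj_def)
  have "dir \<theta> \<noteq> 0" using norm_dir[of \<theta>] by (metis norm_zero zero_neq_one)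
  then have u: "u = x \<bullet> dir \<theta>" using x(2) by simp
  have "E \<noteq> {}" "infdist x E < r" using x(1) by (auto simp: nbhd_def)
  then obtain e where e: "e \<in> E" "dist x e < r"
    by (auto simp: infdist_def cINF_less_iff)
  have "\<bar>(x - e) \<bullet> dir \<theta>\<bar> \<le> norm (x - e)"
    using Cauchy_Schwarz_ineq2[of "x - e" "dir \<theta>"] by simp
  then have "\<bar>u - e \<bullet> dir \<theta>\<bar> < r" using e by (simp add: u dist_norm inner_diff_left)
  then show "u \<in> ?R" using e by (intro UN_I[of e]) (auto simp: abs_if split: if_splits)
next
  fix u assume "u \<in> ?R"
  then obtain e where e: "e \<in> E" "\<bar>u - e \<bullet> dir \<theta>\<bar> < r" by (auto simp: abs_if)
  define x where "x = e + (u - e \<bullet> dir \<theta>) *\<^sub>R dir \<theta>"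
  have dd: "dir \<theta> \<bullet> dir \<theta> = 1" by (metis norm_dir norm_eq_1)
  have "dist x e < r" using e(2) by (simp add: x_def dist_norm)
  then have "infdist x E < r" using infdist_le[OF e(1), of x] by simp
  then have "x \<in> nbhd r E" using e(1) by (auto simp: nbhd_def)
  moreover have "u *\<^sub>R dir \<theta> = proj \<theta> x"
    by (simp add: x_def proj_def inner_add_left dd)
  ultimately show "u \<in> ?L" by auto
qed

text \<open>
  With \<open>f\<close> the sum of the weighted indicators of the intervals and \<open>U\<close> their union,
  this integrates the pointwise inequality \<open>2f - f\<^sup>2/\<mu> \<le> \<mu> \<cdot> 1\<^sub>U\<close>. It is
  the Cauchy-Schwarz bound \<open>(\<integral>f)\<^sup>2 \<le> \<bar>U\<bar> \<integral>f\<^sup>2\<close> in a form linear in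
  \<open>\<bar>U\<bar>\<close>, so that it can be averaged over directions with one common \<open>\<mu>\<close>.
\<close>

lemma weighted_intervals_l2_bound:
  fixes w p :: "'a \<Rightarrow> real"
  assumes X: "finite X" and w: "\<And>x. 0 \<le> w x" and r: "0 < r" and \<mu>: "0 < \<mu>"
  shows "4 * r * sum w X
           - (\<Sum>x\<in>X. \<Sum>y\<in>X. w x * w y * (2 * r) * of_bool (\<bar>p x - p y\<bar> < 2 * r)) / \<mu>
         \<le> \<mu> * measure lborel (\<Union>x\<in>X. {p x - r <..< p x + r})"
proof -
  define J where "J x = {p x - r <..< p x + r}" for x
  define U where "U = (\<Union>x\<in>X. J x)"
  define f where "f u = (\<Sum>x\<in>X. w x * indicator (J x) u)" for u
  have JJ: "J x \<inter> J y \<in> fmeasurable lborel" for x y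
    unfolding J_def by (intro fmeasurableI emeasure_bounded_finite) (auto intro: bounded_Int)
  have J: "J x \<in> fmeasurable lborel" for x using JJ[of x x] by simp
  have U: "U \<in> fmeasurable lborel" unfolding U_def using X J by (intro fmeasurable.finite_UN) auto
  have int_ind: "integrable lborel (\<lambda>u. c * indicator S u :: real)" if "S \<in> fmeasurable lborel" for c S
    using that by (auto simp: fmeasurable_def)
  have f_sq: "(f u)\<^sup>2 = (\<Sum>x\<in>X. \<Sum>y\<in>X. w x * w y * indicator (J x \<inter> J y) u)" for u
    unfolding f_def power2_eq_square sum_product
    by (intro sum.cong refl) (simp add: indicator_inter_arith)
  have int_f: "integrable lborel f"
    unfolding f_def by (intro Bochner_Integration.integrable_sum int_ind J)
  have int_f2: "integrable lborel (\<lambda>u. (f u)\<^sup>2)"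
    unfolding f_sq by (intro Bochner_Integration.integrable_sum int_ind JJ)
  have "(\<integral>u. f u \<partial>lborel) = (\<Sum>x\<in>X. w x * measure lborel (J x))"
    unfolding f_def
    by (subst Bochner_Integration.integral_sum, intro int_ind J) simp
  also have "\<dots> = sum w X * (2 * r)"
    unfolding sum_distrib_right using r by (simp add: J_def)
  finally have I1: "(\<integral>u. f u \<partial>lborel) = 2 * r * sum w X" by simp
  have "(\<integral>u. (f u)\<^sup>2 \<partial>lborel) = (\<Sum>x\<in>X. \<Sum>y\<in>X. w x * w y * measure lborel (J x \<inter> J y))"
    unfolding f_sq
    by (subst Bochner_Integration.integral_sum, intro Bochner_Integration.integrable_sum int_ind JJ,
        subst Bochner_Integration.integral_sum, intro int_ind JJ) simp
  also have "\<dots> \<le> (\<Sum>x\<in>X. \<Sum>y\<in>X. w x * w y * (2 * r) * of_bool (\<bar>p x - p y\<bar> < 2 * r))"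
  proof (intro sum_mono)
    fix x y
    have "measure lborel (J x \<inter> J y) \<le> 2 * r * of_bool (\<bar>p x - p y\<bar> < 2 * r)"
    proof (cases "\<bar>p x - p y\<bar> < 2 * r")
      case True
      have "measure lborel (J x \<inter> J y) \<le> measure lborel (J x)"
        using J[of x] J[of y] by (intro measure_mono_fmeasurable) auto
      then show ?thesis using True r by (simp add: J_def)
    next
      case False
      then have "J x \<inter> J y = {}" by (auto simp: J_def)
      then show ?thesis using False by simp
    qed
    then have "w x * w y * measure lborel (J x \<inter> J y)
        \<le> w x * w y * (2 * r * of_bool (\<bar>p x - p y\<bar> < 2 * r))"
      using w by (intro mult_left_mono) auto
    then show "w x * w y * measure lborel (J x \<inter> J y)
        \<le> w x * w y * (2 * r) * of_bool (\<bar>p x - p y\<bar> < 2 * r)"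
      by (simp add: mult.assoc)
  qed
  finally have I2: "(\<integral>u. (f u)\<^sup>2 \<partial>lborel)
      \<le> (\<Sum>x\<in>X. \<Sum>y\<in>X. w x * w y * (2 * r) * of_bool (\<bar>p x - p y\<bar> < 2 * r))" .
  have pointwise: "2 * f u - (f u)\<^sup>2 / \<mu> \<le> \<mu> * indicator U u" for u
  proof (cases "u \<in> U")
    case True
    have "0 \<le> (f u - \<mu>)\<^sup>2 / \<mu>" using \<mu> by simp
    also have "\<dots> = \<mu> - (2 * f u - (f u)\<^sup>2 / \<mu>)"
      using \<mu> by (simp add: power2_eq_square field_simps)
    finally show ?thesis using True by simp
  next
    case False
    then have "f u = 0" by (auto simp: f_def U_def intro!: sum.neutral)
    then show ?thesis using False by simp
  qed
  have "4 * r * sum w X - (\<integral>u. (f u)\<^sup>2 \<partial>lborel) / \<mu> = (\<integral>u. 2 * f u - (f u)\<^sup>2 / \<mu> \<partial>lborel)"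
    using int_f int_f2 by (simp add: I1)
  also have "\<dots> \<le> (\<integral>u. \<mu> * indicator U u \<partial>lborel)"
    using int_f int_f2 U by (intro integral_mono pointwise int_ind) auto
  also have "\<dots> = \<mu> * measure lborel U" by simp
  finally show ?thesis
    using I2 divide_right_mono[OF I2, of \<mu>] \<mu> unfolding U_def J_def by linarith
qed

lemma projected_mass_bound:
  fixes E X :: "(real ^ 2) set" and w :: "real ^ 2 \<Rightarrow> real"
  assumes X: "finite X" "X \<subseteq> E" and w: "\<And>x. 0 \<le> w x" and r: "0 < r" and \<mu>: "0 < \<mu>"
  shows "ennreal (4 * r * sum w X / \<mu>
           - (\<Sum>x\<in>X. \<Sum>y\<in>X. w x * w y * (2 * r) * of_bool (\<bar>(x - y) \<bullet> dir \<theta>\<bar> < 2 * r)) / \<mu>\<^sup>2)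
         \<le> line_length \<theta> (proj \<theta> ` nbhd r E)"
proof -
  define J where "J x = {x \<bullet> dir \<theta> - r <..< x \<bullet> dir \<theta> + r}" for x
  define S where "S = (\<Sum>x\<in>X. \<Sum>y\<in>X. w x * w y * (2 * r) * of_bool (\<bar>(x - y) \<bullet> dir \<theta>\<bar> < 2 * r))"
  have "4 * r * sum w X - S / \<mu> \<le> \<mu> * measure lborel (\<Union>x\<in>X. J x)"
    using weighted_intervals_l2_bound[OF X(1) w r \<mu>, where p = "\<lambda>x. x \<bullet> dir \<theta>"]
    by (simp add: S_def J_def inner_diff_left)
  then have "(4 * r * sum w X - S / \<mu>) / \<mu> \<le> measure lborel (\<Union>x\<in>X. J x)"
    using \<mu> by (simp add: field_simps)
  also have "(4 * r * sum w X - S / \<mu>) / \<mu> = 4 * r * sum w X / \<mu> - S / \<mu>\<^sup>2"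
    using \<mu> by (simp add: field_simps power2_eq_square)
  finally have "ennreal (4 * r * sum w X / \<mu> - S / \<mu>\<^sup>2) \<le> ennreal (measure lborel (\<Union>x\<in>X. J x))"
    by (rule ennreal_leI)
  also have "\<dots> = emeasure lborel (\<Union>x\<in>X. J x)"
    using X(1) by (intro emeasure_eq_measure2[symmetric] fmeasurable.finite_UN)
      (auto simp: J_def intro!: fmeasurableI emeasure_bounded_finite)
  also have "\<dots> = emeasure lebesgue (\<Union>x\<in>X. J x)"
  proof -
    have "(\<Union>x\<in>X. J x) \<in> sets lborel"
      using X(1) by (intro sets.finite_UN) (auto simp: J_def)
    then show ?thesis by simp
  qed
  also have "\<dots> \<le> emeasure lebesgue (\<Union>x\<in>E. J x)"
  proof (rule emeasure_mono)
    have "open (\<Union>x\<in>E. J x)" by (auto simp: J_def)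
    then show "(\<Union>x\<in>E. J x) \<in> sets lebesgue" by simp
  qed (use X(2) in auto)
  also have "\<dots> = line_length \<theta> (proj \<theta> ` nbhd r E)"
    by (simp add: line_length_def proj_nbhd_preimage J_def)
  finally show ?thesis by (simp add: S_def)
qed

text \<open>
  The heart of the argument, in the manner of Kaufman. Averaging the preceding lower bound over
  \<open>\<theta> \<in> A\<close> replaces each overlap condition by the measure of the directions satisfying it, which
  is dominated by the dyadic kernel of the distance of the two points; the ball condition then
  bounds the total overlap by \<open>2 r q\<close> times the mass, with \<open>q\<close> of order
  \<open>r\<^sup>t\<close>. The result is a bound on the mass by the average length \<open>D\<close> of the
  projections, up to the factor \<open>r\<^sup>t\<^sup>-\<^sup>1\<close>.
\<close>

lemma mass_le_projection_average:
  fixes E X :: "(real ^ 2) set" and w :: "real ^ 2 \<Rightarrow> real"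
  assumes X: "finite X" "X \<subseteq> E" and w: "\<And>x. 0 \<le> w x" and r: "0 < r" and t: "t < 1"
    and ball: "\<And>x k. x \<in> X \<Longrightarrow> k \<le> N \<Longrightarrow> sum w (X \<inter> cball x (2^k * r)) \<le> (2^k * r) powr t"
    and diam: "\<And>x y. x \<in> X \<Longrightarrow> y \<in> X \<Longrightarrow> dist x y \<le> 2 ^ N * r"
    and A: "A \<subseteq> {0..<2 * pi}" "A \<in> sets lebesgue" "0 < measure lebesgue A"
    and D: "0 \<le> D" "(\<integral>\<^sup>+\<theta>\<in>A. line_length \<theta> (proj \<theta> ` nbhd r E) \<partial>lebesgue) \<le> ennreal D"
  shows "sum w X \<le> 8 * pi / ((1 - 2 powr (t - 1)) * (measure lebesgue A)\<^sup>2) * D * r powr (t - 1)"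
proof -
  define a where "a = measure lebesgue A"
  define q where "q = 16 * pi * (r powr t / (1 - 2 powr (t - 1)))"
  \<comment> \<open>The mass term is \<open>4rWa/\<mu>\<close> and the overlap term at most \<open>2rWq/\<mu>\<^sup>2\<close>: this choice makes the
      former twice the latter.\<close>
  define \<mu> where "\<mu> = q / a"
  define W where "W = sum w X"
  have "2 powr (t - 1) < (1::real)" using t by (simp add: powr_less_one)
  then have q: "0 < q" using r by (simp add: q_def)
  have a: "0 < a" using A by (simp add: a_def)
  then have \<mu>: "0 < \<mu>" using q by (simp add: \<mu>_def)
  define T where "T v = A \<inter> {\<theta>. \<bar>v \<bullet> dir \<theta>\<bar> < 2 * r}" for v :: "real ^ 2"
  have Af: "A \<in> fmeasurable lebesgue"
    using A(1,2) by (intro bounded_set_imp_lmeasurable) (auto intro: bounded_subset[of "{0..<2*pi}"])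
  have Tf: "T v \<in> fmeasurable lebesgue" for v
    unfolding T_def by (rule fmeasurableI2[OF Af]) (auto intro: sets_thin_angles A)
  have int_ind: "integrable lebesgue (\<lambda>u. c * indicator S u :: real)" if "S \<in> fmeasurable lebesgue" for c S
    using that by (auto simp: fmeasurable_def)
  \<comment> \<open>On \<open>A\<close>, this is the lower bound for the projected length; elsewhere it vanishes.\<close>
  define H where "H \<theta> = 4 * r * W / \<mu> * indicator A \<theta>
      - (\<Sum>x\<in>X. \<Sum>y\<in>X. w x * w y * (2 * r) / \<mu>\<^sup>2 * indicator (T (x - y)) \<theta>)" for \<theta>
  have H_sum_int: "integrable lebesgue (\<lambda>\<theta>. \<Sum>y\<in>X. w x * w y * (2 * r) / \<mu>\<^sup>2 * indicator (T (x - y)) \<theta>)" for x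
    by (intro Bochner_Integration.integrable_sum int_ind Tf)
  have H_int: "integrable lebesgue H"
    unfolding H_def
    by (intro Bochner_Integration.integrable_diff Bochner_Integration.integrable_sum H_sum_int int_ind Af)
  have "(\<integral>\<theta>. H \<theta> \<partial>lebesgue) = 4 * r * W / \<mu> * a
      - (\<Sum>x\<in>X. \<Sum>y\<in>X. w x * w y * (2 * r) / \<mu>\<^sup>2 * measure lebesgue (T (x - y)))"
  proof -
    have "(\<integral>\<theta>. (\<Sum>y\<in>X. w x * w y * (2 * r) / \<mu>\<^sup>2 * indicator (T (x - y)) \<theta>) \<partial>lebesgue)
        = (\<Sum>y\<in>X. w x * w y * (2 * r) / \<mu>\<^sup>2 * measure lebesgue (T (x - y)))" for x
      by (subst Bochner_Integration.integral_sum, intro int_ind Tf) simp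
    then show ?thesis
      unfolding H_def
      by (subst Bochner_Integration.integral_diff,
          intro int_ind Af, intro Bochner_Integration.integrable_sum H_sum_int,
          subst Bochner_Integration.integral_sum, intro H_sum_int)
         (simp add: a_def)
  qed
  moreover have "(\<Sum>x\<in>X. \<Sum>y\<in>X. w x * w y * (2 * r) / \<mu>\<^sup>2 * measure lebesgue (T (x - y)))
      \<le> (2 * r / \<mu>\<^sup>2) * (q * W)"
  proof -
    have "(\<Sum>y\<in>X. w x * w y * (2 * r) / \<mu>\<^sup>2 * measure lebesgue (T (x - y)))
        \<le> (2 * r / \<mu>\<^sup>2) * (q * w x)" if x: "x \<in> X" for x
    proof -
      have "(\<Sum>y\<in>X. w x * w y * (2 * r) / \<mu>\<^sup>2 * measure lebesgue (T (x - y)))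
          \<le> (\<Sum>y\<in>X. w x * w y * (2 * r) / \<mu>\<^sup>2 * (16 * pi * dyadic_kernel r N (dist x y)))"
        unfolding T_def dist_norm using diam[OF x] w r
        by (intro sum_mono mult_left_mono measure_thin_angles_le_dyadic_kernel A)
           (auto simp: dist_norm)
      also have "\<dots> = (2 * r / \<mu>\<^sup>2) * w x * (16 * pi * (\<Sum>y\<in>X. w y * dyadic_kernel r N (dist x y)))"
        by (simp add: sum_distrib_left algebra_simps)
      also have "\<dots> \<le> (2 * r / \<mu>\<^sup>2) * w x * q"
        unfolding q_def using w r
        by (intro mult_left_mono dyadic_kernel_sum_le X r t ball x) auto
      finally show ?thesis by (simp add: algebra_simps)
    qed
    then have "(\<Sum>x\<in>X. \<Sum>y\<in>X. w x * w y * (2 * r) / \<mu>\<^sup>2 * measure lebesgue (T (x - y)))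
        \<le> (\<Sum>x\<in>X. (2 * r / \<mu>\<^sup>2) * (q * w x))"
      by (rule sum_mono)
    also have "\<dots> = (2 * r / \<mu>\<^sup>2) * (q * W)" by (simp add: W_def sum_distrib_left)
    finally show ?thesis .
  qed
  moreover have "(\<integral>\<theta>. H \<theta> \<partial>lebesgue) \<le> D"
  proof (rule integral_real_bounded[OF D(1)])
    have "(\<integral>\<^sup>+\<theta>. ennreal (H \<theta>) \<partial>lebesgue)
        \<le> (\<integral>\<^sup>+\<theta>\<in>A. line_length \<theta> (proj \<theta> ` nbhd r E) \<partial>lebesgue)"
    proof (rule nn_integral_mono)
      fix \<theta> :: real
      show "ennreal (H \<theta>) \<le> line_length \<theta> (proj \<theta> ` nbhd r E) * indicator A \<theta>"
      proof (cases "\<theta> \<in> A")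
        case True
        then have "H \<theta> = 4 * r * sum w X / \<mu>
           - (\<Sum>x\<in>X. \<Sum>y\<in>X. w x * w y * (2 * r) * of_bool (\<bar>(x - y) \<bullet> dir \<theta>\<bar> < 2 * r)) / \<mu>\<^sup>2"
          by (auto simp: H_def W_def T_def sum_divide_distrib intro!: sum.cong)
        then show ?thesis
          using projected_mass_bound[OF X w r \<mu>, where \<theta> = \<theta>] True by simp
      next
        case False
        then have "H \<theta> = 0" by (simp add: H_def T_def)
        then show ?thesis by simp
      qed
    qed
    also note D(2)
    finally show "(\<integral>\<^sup>+\<theta>. ennreal (H \<theta>) \<partial>lebesgue) \<le> ennreal D" .
  qed
  ultimately have "4 * r * W / \<mu> * a - (2 * r / \<mu>\<^sup>2) * (q * W) \<le> D" by linarith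
  also have "4 * r * W / \<mu> * a - (2 * r / \<mu>\<^sup>2) * (q * W) = 2 * r * W * a\<^sup>2 / q"
    using q a by (simp add: \<mu>_def power2_eq_square field_simps)
  finally have "W \<le> D * q / (2 * r * a\<^sup>2)"
    using q a r by (simp add: field_simps)
  also have "\<dots> = 8 * pi / ((1 - 2 powr (t - 1)) * a\<^sup>2) * D * (r powr t / r)"
    by (simp add: q_def mult_ac)
  also have "r powr t / r = r powr (t - 1)" using r by (simp add: powr_diff)
  finally show ?thesis by (simp add: W_def a_def)
qed

section \<open>Null sets of Hausdorff measure\<close>

text \<open>
  As \<open>t > 0\<close>, a small sum of powers of diameters forces every diameter to be small, so
  economical covers are automatically fine ones. Countably many finite covers
  are merged into one sequence by the pairing bijection, the \<open>m\<close>-th one with budget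
  \<open>\<epsilon>/2\<^sup>m\<^sup>+\<^sup>1\<close>.
\<close>

lemma hausdorff_measure_Union_eq_0:
  fixes E :: "nat \<Rightarrow> 'a::euclidean_space set"
  assumes t: "0 < t"
    and cov: "\<And>m \<epsilon>. 0 < \<epsilon> \<Longrightarrow> \<exists>D. finite D \<and> (\<forall>(x,\<rho>)\<in>D. 0 \<le> \<rho>) \<and> E m \<subseteq> (\<Union>(x,\<rho>)\<in>D. cball x \<rho>)
          \<and> (\<Sum>(x,\<rho>)\<in>D. (2 * \<rho>) powr t) \<le> \<epsilon>"
  shows "hausdorff_measure t (\<Union>m. E m) = 0"
proof -
  have pre: "hausdorff_premeasure t \<delta> (\<Union>m. E m) \<le> ennreal \<epsilon>" if \<delta>: "0 < \<delta>" and \<epsilon>: "0 < \<epsilon>" for \<delta> \<epsilon>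
  proof -
    \<comment> \<open>The bound by \<open>\<delta>\<^sup>t\<close> is what keeps each diameter below \<open>\<delta>\<close>.\<close>
    define \<eta> where "\<eta> m = min (\<delta> powr t) (\<epsilon> * (1/2) ^ Suc m)" for m
    have \<eta>: "0 < \<eta> m" for m using \<delta> \<epsilon> by (simp add: \<eta>_def)
    have "\<forall>m. \<exists>D. finite D \<and> (\<forall>(x,\<rho>)\<in>D. 0 \<le> \<rho>) \<and> E m \<subseteq> (\<Union>(x,\<rho>)\<in>D. cball x \<rho>)
          \<and> (\<Sum>(x,\<rho>)\<in>D. (2 * \<rho>) powr t) \<le> \<eta> m" using cov \<eta> by blast
    then obtain D where D: "\<forall>m. finite (D m) \<and> (\<forall>(x,\<rho>)\<in>D m. 0 \<le> \<rho>) \<and> E m \<subseteq> (\<Union>(x,\<rho>)\<in>D m. cball x \<rho>)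
          \<and> (\<Sum>(x,\<rho>)\<in>D m. (2 * \<rho>) powr t) \<le> \<eta> m" by (rule choice[THEN exE])
    then have fin: "finite (D m)" and nn: "(x,\<rho>) \<in> D m \<Longrightarrow> 0 \<le> \<rho>"
      and E: "E m \<subseteq> (\<Union>(x,\<rho>)\<in>D m. cball x \<rho>)"
      and S: "(\<Sum>(x,\<rho>)\<in>D m. (2 * \<rho>) powr t) \<le> \<eta> m" for m x \<rho>
      by auto
    have "\<forall>m. \<exists>e. bij_betw e {0..<card (D m)} (D m)"
      using ex_bij_betw_nat_finite fin by blast
    then obtain e where e: "\<And>m. bij_betw (e m) {0..<card (D m)} (D m)"
      by metis
    define V where "V = (\<lambda>(m, i). if i < card (D m) then cball (fst (e m i)) (snd (e m i)) else {})"
    define U where "U j = V (prod_decode j)" for j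
    have e_in: "e m i \<in> D m" if "i < card (D m)" for m i
      using e[of m] that by (auto simp: bij_betw_def)
    have e_nn: "0 \<le> snd (e m i)" if "i < card (D m)" for m i
      using nn[of "fst (e m i)" "snd (e m i)"] e_in[OF that] by simp
    have V_bound: "bounded (V p) \<and> diameter (V p) \<le> \<delta>" for p
    proof -
      obtain m i where p: "p = (m, i)" by fastforce
      show ?thesis
      proof (cases "i < card (D m)")
        case True
        define \<rho> where "\<rho> = snd (e m i)"
        have \<rho>: "0 \<le> \<rho>" unfolding \<rho>_def by (rule e_nn[OF True])
        have "(2 * \<rho>) powr t \<le> (\<Sum>(x,\<rho>)\<in>D m. (2 * \<rho>) powr t)"
          using member_le_sum[OF e_in[OF True] _ fin, of "\<lambda>(x,\<rho>). (2 * \<rho>) powr t"]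
          by (auto simp: \<rho>_def case_prod_unfold)
        also have "\<dots> \<le> \<delta> powr t" using S[of m] by (simp add: \<eta>_def)
        finally have "2 * \<rho> \<le> \<delta>"
          using powr_less_mono2[of t \<delta> "2 * \<rho>"] t \<delta> by (cases "2 * \<rho> \<le> \<delta>") auto
        then show ?thesis using True \<rho> \<delta> by (simp add: p V_def \<rho>_def[symmetric] diameter_cball)
      qed (use \<delta> in \<open>simp add: p V_def\<close>)
    qed
    have cover: "(\<Union>m. E m) \<subseteq> (\<Union>j. U j)"
    proof
      fix y assume "y \<in> (\<Union>m. E m)"
      then obtain m x \<rho> where "(x,\<rho>) \<in> D m" "y \<in> cball x \<rho>" using E by blast
      moreover then obtain i where "i < card (D m)" "e m i = (x,\<rho>)"
        using e[of m] unfolding bij_betw_def by (metis imageE atLeastLessThan_iff)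
      ultimately have "y \<in> U (prod_encode (m, i))" by (simp add: U_def V_def)
      then show "y \<in> (\<Union>j. U j)" by blast
    qed
    have row: "(\<Sum>i. ennreal (diam_powr t (V (m, i)))) \<le> ennreal (\<epsilon> * (1/2) ^ Suc m)" for m
    proof -
      have "(\<Sum>i. ennreal (diam_powr t (V (m, i)))) = (\<Sum>i\<in>{0..<card (D m)}. ennreal (diam_powr t (V (m, i))))"
        by (intro suminf_finite) (auto simp: V_def diam_powr_def)
      also have "\<dots> = (\<Sum>i\<in>{0..<card (D m)}. ennreal ((2 * snd (e m i)) powr t))"
        using t e_nn by (intro sum.cong) (auto simp: V_def diam_powr_def diameter_cball not_less[symmetric])
      also have "\<dots> = ennreal (\<Sum>i\<in>{0..<card (D m)}. (2 * snd (e m i)) powr t)"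
        by (intro sum_ennreal) auto
      also have "(\<Sum>i\<in>{0..<card (D m)}. (2 * snd (e m i)) powr t) = (\<Sum>p\<in>D m. (2 * snd p) powr t)"
        by (rule sum.reindex_bij_betw[OF e])
      also have "\<dots> \<le> \<epsilon> * (1/2) ^ Suc m"
        using S[of m] by (simp add: \<eta>_def case_prod_unfold)
      finally show ?thesis by (simp add: ennreal_leI)
    qed
    have "(\<Sum>j. ennreal (diam_powr t (U j))) = (\<Sum>m. \<Sum>i. ennreal (diam_powr t (V (m, i))))"
      unfolding U_def by (rule suminf_ennreal_2dimen[where f = "\<lambda>p. ennreal (diam_powr t (V p))"]) simp
    also have "\<dots> \<le> (\<Sum>m. ennreal (\<epsilon> * (1/2) ^ Suc m))"
      by (intro suminf_le row) auto
    also have "\<dots> = ennreal \<epsilon>"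
      using sums_mult[OF power_half_series, of \<epsilon>] \<epsilon> by (intro suminf_ennreal_eq) auto
    finally have "(\<Sum>j. ennreal (diam_powr t (U j))) \<le> ennreal \<epsilon>" .
    then show ?thesis
      unfolding hausdorff_premeasure_def using cover V_bound
      by (intro INF_lower2[of U]) (auto simp: U_def)
  qed
  have "hausdorff_premeasure t \<delta> (\<Union>m. E m) = 0" if "0 < \<delta>" for \<delta>
  proof -
    have "hausdorff_premeasure t \<delta> (\<Union>m. E m) \<le> 0"
    proof (rule ennreal_le_epsilon)
      show "hausdorff_premeasure t \<delta> (\<Union>m. E m) \<le> 0 + ennreal \<epsilon>" if "0 < \<epsilon>" for \<epsilon>
        using pre[OF \<open>0 < \<delta>\<close> that] by simp
    qed
    then show ?thesis by simp
  qed
  then show ?thesis unfolding hausdorff_measure_def by (simp add: SUP_constant)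
qed

lemma finite_net_of_bounded:
  fixes S :: "'a::heine_borel set"
  assumes "bounded S" "0 < r"
  obtains X where "finite X" "X \<subseteq> S" "S \<subseteq> (\<Union>x\<in>X. ball x r)"
proof -
  have "compact (closure S)" using assms by (simp add: compact_closure)
  moreover have "\<And>x. x \<in> S \<Longrightarrow> open (ball x r)" by simp
  moreover have "closure S \<subseteq> (\<Union>x\<in>S. ball x r)"
    using assms(2) by (auto simp: closure_approachable dist_commute)
  ultimately obtain X where X: "X \<subseteq> S" "finite X" "closure S \<subseteq> (\<Union>x\<in>X. ball x r)"
    by (rule compactE_image)
  show ?thesis
    by (rule that[OF X(2,1) order.trans[OF closure_subset X(3)]])
qed

section \<open>The dimension bound\<close>

theorem theorem2p1:
  fixes s :: real and E :: "(real ^ 2) set" and A :: "real set"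
    and r :: "nat \<Rightarrow> real" and C :: ennreal
  assumes "0 < s" and "s < 1"
    and "E \<in> sets lebesgue"
    and "A \<subseteq> {0..<2 * pi}" and "A \<in> sets lebesgue" and "emeasure lebesgue A > 0"
    and "\<And>n. r n > 0" and "r \<longlonglongrightarrow> 0"
    and "C < \<infinity>"
    and "\<And>n. (\<integral>\<^sup>+\<theta>\<in>A. line_length \<theta> (proj \<theta> ` nbhd (r n) E) \<partial>lebesgue)
               \<le> C * ennreal (r n powr s)"
  shows "hausdorff_dim E \<le> ennreal (1 - s)"
proof -
  note A = assms(4,5) and r = assms(7)
  have "A \<in> lmeasurable"
    using A by (intro bounded_set_imp_lmeasurable) (auto intro: bounded_subset[of "{0..<2*pi}"])
  then have a: "0 < measure lebesgue A"
    using assms(6) by (simp add: emeasure_eq_measure2)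
  define M where "M = enn2real C"
  have M: "0 \<le> M" "C = ennreal M" using assms(9) by (auto simp: M_def)
  have null: "hausdorff_measure t E = 0" if t: "1 - s < t" "t < 1" for t
  proof -
    have t0: "0 < t" using t assms(2) by simp
    \<comment> \<open>All that depends on neither the scale nor the covered piece.\<close>
    define K where "K = 8 * pi / ((1 - 2 powr (t - 1)) * (measure lebesgue A)\<^sup>2) * M"
    have "(\<lambda>n. r n powr (s + t - 1)) \<longlonglongrightarrow> 0"
      using assms(8) t r by (intro tendsto_zero_powrI[where b = "s + t - 1"]) (auto simp: less_imp_le)
    then have lim: "(\<lambda>n. 12 powr t * (K * r n powr (s + t - 1))) \<longlonglongrightarrow> 0"
      by (intro tendsto_mult_right_zero)
    have "hausdorff_measure t (\<Union>m. E \<inter> cball 0 (real m)) = 0"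
    proof (rule hausdorff_measure_Union_eq_0[OF t0])
      fix m :: nat and \<epsilon> :: real assume \<epsilon>: "0 < \<epsilon>"
      have "eventually (\<lambda>n. 12 powr t * (K * r n powr (s + t - 1)) < \<epsilon>) sequentially"
        using order_tendstoD(2)[OF lim \<epsilon>] .
      then obtain n where n: "12 powr t * (K * r n powr (s + t - 1)) < \<epsilon>"
        by (auto simp: eventually_sequentially)
      have "bounded (E \<inter> cball 0 (real m))" by (simp add: bounded_Int)
      then obtain X where X: "finite X" "X \<subseteq> E \<inter> cball 0 (real m)"
        and net: "E \<inter> cball 0 (real m) \<subseteq> (\<Union>x\<in>X. ball x (r n))"
        using finite_net_of_bounded[OF _ r] by metis
      \<comment> \<open>The largest balls must reach the diameter of the piece.\<close>
      obtain N where "2 * real m / r n < 2 ^ N"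
        using real_arch_pow[of 2] by auto
      then have N: "2 * real m \<le> 2 ^ N * r n" using r[of n] by (simp add: field_simps)
      have diam: "dist x y \<le> 2 ^ N * r n" if "x \<in> X" "y \<in> X" for x y
      proof -
        have "norm x \<le> m" "norm y \<le> m" using X(2) that by auto
        then have "dist x y \<le> 2 * real m" using norm_triangle_ineq4[of x y] by (simp add: dist_norm)
        then show ?thesis using N by simp
      qed
      obtain w D where w: "\<And>x. 0 \<le> w x"
        and ball: "\<And>x k. x \<in> X \<Longrightarrow> k \<le> N \<Longrightarrow> sum w (X \<inter> cball x (2^k * r n)) \<le> (2^k * r n) powr t"
        and D: "finite D" "X \<subseteq> (\<Union>(x,k)\<in>D. cball x (5 * (2^k * r n)))"
        and sumD: "(\<Sum>(x,k)\<in>D. (2^k * r n) powr t) \<le> sum w X"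
        using discrete_frostman[OF X(1) r, of N n t] by blast
      have "sum w X \<le> 8 * pi / ((1 - 2 powr (t - 1)) * (measure lebesgue A)\<^sup>2) * (M * r n powr s) * r n powr (t - 1)"
      proof (rule mass_le_projection_average[OF X(1) _ w r t(2) ball diam A a])
        show "X \<subseteq> E" using X(2) by simp
        show "(\<integral>\<^sup>+\<theta>\<in>A. line_length \<theta> (proj \<theta> ` nbhd (r n) E) \<partial>lebesgue) \<le> ennreal (M * r n powr s)"
          using assms(10)[of n] M by (simp add: ennreal_mult)
      qed (use M in auto)
      also have "\<dots> = K * r n powr (s + t - 1)"
        by (simp add: K_def powr_add[symmetric] algebra_simps)
      finally have W: "sum w X \<le> K * r n powr (s + t - 1)" .
      \<comment> \<open>Enlarging \<open>5\<cdot>2\<^sup>k r\<close> to \<open>6\<cdot>2\<^sup>k r\<close> absorbs the error \<open>r\<close> of the net.\<close>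
      define b where "b = (\<lambda>(x::real^2, k::nat). (x, 6 * (2^k * r n)))"
      show "\<exists>D. finite D \<and> (\<forall>(x,\<rho>)\<in>D. 0 \<le> \<rho>) \<and> E \<inter> cball 0 (real m) \<subseteq> (\<Union>(x,\<rho>)\<in>D. cball x \<rho>)
          \<and> (\<Sum>(x,\<rho>)\<in>D. (2 * \<rho>) powr t) \<le> \<epsilon>"
      proof (intro exI[of _ "b ` D"] conjI)
        show "finite (b ` D)" using D by simp
        show "\<forall>(x,\<rho>)\<in>b ` D. 0 \<le> \<rho>" using r[of n] by (auto simp: b_def)
        show "E \<inter> cball 0 (real m) \<subseteq> (\<Union>(x,\<rho>)\<in>b ` D. cball x \<rho>)"
        proof
          fix y assume "y \<in> E \<inter> cball 0 (real m)"
          then obtain x where x: "x \<in> X" "dist x y < r n" using net by auto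
          then obtain z k where z: "(z,k) \<in> D" "dist z x \<le> 5 * (2^k * r n)" using D(2) by auto
          have "r n \<le> 2^k * r n" using r[of n] by simp
          then have "dist z y \<le> 6 * (2^k * r n)"
            using dist_triangle[of z y x] x(2) z(2) by linarith
          then have "y \<in> cball z (6 * (2^k * r n))" by simp
          moreover have "(z, 6 * (2^k * r n)) \<in> b ` D"
            using z(1) by (force simp: b_def)
          ultimately show "y \<in> (\<Union>(x,\<rho>)\<in>b ` D. cball x \<rho>)" by blast
        qed
        have "(\<Sum>(x,\<rho>)\<in>b ` D. (2 * \<rho>) powr t) \<le> (\<Sum>i\<in>D. ((\<lambda>(x,\<rho>). (2 * \<rho>) powr t) \<circ> b) i)"
          using D(1) by (intro sum_image_le) (auto simp: case_prod_unfold)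
        also have "\<dots> = (\<Sum>(x,k)\<in>D. 12 powr t * (2^k * r n) powr t)"
        proof (rule sum.cong[OF refl])
          fix i assume "i \<in> D"
          obtain x k where i: "i = (x,k)" by fastforce
          have "(2 * (6 * (2^k * r n))) = 12 * (2^k * r n)" by simp
          then show "((\<lambda>(x,\<rho>). (2 * \<rho>) powr t) \<circ> b) i = (case i of (x,k) \<Rightarrow> 12 powr t * (2^k * r n) powr t)"
            using powr_mult[of 12 "2^k * r n" t] r[of n] by (simp add: i b_def)
        qed
        also have "\<dots> = 12 powr t * (\<Sum>(x,k)\<in>D. (2^k * r n) powr t)"
          by (simp add: sum_distrib_left case_prod_unfold)
        also have "\<dots> \<le> 12 powr t * (K * r n powr (s + t - 1))"
          using sumD W by (intro mult_left_mono) auto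
        also have "\<dots> \<le> \<epsilon>" using n by simp
        finally show "(\<Sum>(x,\<rho>)\<in>b ` D. (2 * \<rho>) powr t) \<le> \<epsilon>" .
      qed
    qed
    moreover have "(\<Union>m. E \<inter> cball 0 (real m)) = E"
      using real_arch_simple by auto
    ultimately show ?thesis by simp
  qed
  show ?thesis
  proof (rule ennreal_le_epsilon)
    fix e :: real assume e: "0 < e"
    \<comment> \<open>The second term of the minimum keeps the exponent below 1.\<close>
    define t where "t = 1 - s + min e (s / 2)"
    have t: "1 - s < t" "t < 1" "t \<le> 1 - s + e" using e assms(1) by (auto simp: t_def min_def)
    then have "0 \<le> t" using assms(2) by linarith
    then have "hausdorff_dim E \<le> ennreal t"
      unfolding hausdorff_dim_def using null[OF t(1,2)] by (intro Inf_lower) auto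
    also have "\<dots> \<le> ennreal (1 - s + e)" using t(3) by (rule ennreal_leI)
    also have "\<dots> = ennreal (1 - s) + ennreal e"
      using assms(2) e by (intro ennreal_plus) auto
    finally show "hausdorff_dim E \<le> ennreal (1 - s) + ennreal e" .
  qed
qed

end
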